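(* Let $\mathfrak{F}$ be a solvable subgroup-closed formation and let $G$ be a finite group. If $A$ is a solvable $\mathrm{K}\mathfrak{F}$-subnormal subgroup of $G$, then $\langle A,B\rangle$ is solvable for any solvable subgroup $B$ of $G$.
   Context: All groups are finite. A formation is a class $\mathfrak{F}$ of groups (closed under isomorphism) that is closed under quotients and such that $G/N_1, G/N_2\in\mathfrak{F}$ with $N_1,N_2\lhd G$ implies $G/(N_1\cap N_2)\in\mathfrak{F}$. It is subgroup-closed if every subgroup of a group in $\mathfrak{F}$ lies in $\mathfrak{F}$, and solvable if every group in $\mathfrak{F}$ is solvable. The $\mathfrak{F}$-residual $G^{\mathfrak{F}}$ of a group $G$ is the intersection of all normal subgroups $N$ of $G$ with $G/N\in\mathfrak{F}$. A subgroup $H$ of $G$ is $\mathrm{K}\mathfrak{F}$-subnormal in $G$ if there is a chain of subgroups $H=H_0\le H_1\le\dots\le H_n=G$ such that for every $i$ either $H_i$ is normal in $H_{i+1}$ or $H_{i+1}^{\mathfrak{F}}\le H_i$. *)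

theory Defs
  imports "HOL-Algebra.Algebra"
begin

text \<open>
  A class of finite groups has members of arbitrary underlying type, which a single HOL
  predicate cannot range over. Since classes of groups here are closed under isomorphism and
  every finite group is isomorphic to one whose carrier is a set of natural numbers, such a
  class is represented by the set \<open>\<FF>\<close> of its members with carrier of type \<^typ>\<open>nat set\<close>; a finite
  group of any type belongs to the class if it is isomorphic to a member of \<open>\<FF>\<close>. The lemmas
  \<open>finite_group_nat_copy\<close> and \<open>in_class_nat\<close> show that nothing is lost.
\<close>

definition group_class :: "nat monoid set \<Rightarrow> bool" where
  "group_class \<FF> \<longleftrightarrow>
     (\<forall>G\<in>\<FF>. group G \<and> finite (carrier G)) \<and>
     (\<forall>G\<in>\<FF>. \<forall>H. group H \<and> G \<cong> H \<longrightarrow> H \<in> \<FF>)"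

definition in_class :: "nat monoid set \<Rightarrow> ('a, 'b) monoid_scheme \<Rightarrow> bool" where
  "in_class \<FF> G \<longleftrightarrow> group G \<and> (\<exists>H\<in>\<FF>. H \<cong> G)"

definition formation :: "nat monoid set \<Rightarrow> bool" where
  "formation \<FF> \<longleftrightarrow>
     group_class \<FF> \<and>
     (\<forall>G\<in>\<FF>. \<forall>N. N \<lhd> G \<longrightarrow> in_class \<FF> (G Mod N)) \<and>
     (\<forall>G :: nat monoid. \<forall>N\<^sub>1 N\<^sub>2. group G \<and> finite (carrier G) \<and> N\<^sub>1 \<lhd> G \<and> N\<^sub>2 \<lhd> G \<and>
        in_class \<FF> (G Mod N\<^sub>1) \<and> in_class \<FF> (G Mod N\<^sub>2) \<longrightarrow> in_class \<FF> (G Mod (N\<^sub>1 \<inter> N\<^sub>2)))"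

definition subgroup_closed :: "nat monoid set \<Rightarrow> bool" where
  "subgroup_closed \<FF> \<longleftrightarrow> (\<forall>G\<in>\<FF>. \<forall>H. subgroup H G \<longrightarrow> in_class \<FF> (G\<lparr>carrier := H\<rparr>))"

definition solvable_class :: "nat monoid set \<Rightarrow> bool" where
  "solvable_class \<FF> \<longleftrightarrow> (\<forall>G\<in>\<FF>. solvable G)"

text \<open>
  Intersecting with \<^term>\<open>carrier G\<close> only matters for the empty class, where the empty
  intersection is thereby read inside \<open>G\<close>: a nonempty formation contains the trivial group, so
  \<^term>\<open>carrier G\<close> is then one of the intersected normal subgroups.
\<close>

definition residual :: "nat monoid set \<Rightarrow> ('a, 'b) monoid_scheme \<Rightarrow> 'a set" where
  "residual \<FF> G = carrier G \<inter> \<Inter>{N. N \<lhd> G \<and> in_class \<FF> (G Mod N)}"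

definition KF_subnormal ::
  "nat monoid set \<Rightarrow> 'a set \<Rightarrow> ('a, 'b) monoid_scheme \<Rightarrow> bool" where
  "KF_subnormal \<FF> H G \<longleftrightarrow>
     (\<exists>(n::nat) C. C 0 = H \<and> C n = carrier G \<and> (\<forall>i\<le>n. subgroup (C i) G) \<and>
        (\<forall>i<n. C i \<subseteq> C (Suc i) \<and>
           (C i \<lhd> G\<lparr>carrier := C (Suc i)\<rparr> \<or>
            residual \<FF> (G\<lparr>carrier := C (Suc i)\<rparr>) \<subseteq> C i)))"

lemma in_class_nat:
  fixes G :: "nat monoid"
  assumes "group_class \<FF>"
  shows "in_class \<FF> G \<longleftrightarrow> G \<in> \<FF>"
  using assms iso_refl unfolding in_class_def group_class_def by blast

lemma finite_group_nat_copy: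
  assumes "group G" "finite (carrier G)"
  shows "\<exists>H :: nat monoid. group H \<and> finite (carrier H) \<and> H \<cong> G"
proof -
  interpret group G by fact
  obtain f :: "'a \<Rightarrow> nat" where f: "inj_on f (carrier G)"
    using assms(2) finite_imp_inj_to_nat_seg by blast
  define g where "g = inv_into (carrier G) f"
  have gf [simp]: "g (f x) = x" if "x \<in> carrier G" for x
    using f that by (simp add: g_def)
  define H :: "nat monoid" where
    "H = \<lparr>carrier = f ` carrier G, monoid.mult = (\<lambda>x y. f (g x \<otimes>\<^bsub>G\<^esub> g y)), one = f \<one>\<^bsub>G\<^esub>\<rparr>"
  have H: "group H"
  proof (rule groupI)
    fix x assume "x \<in> carrier H"
    then obtain a where a: "a \<in> carrier G" "x = f a" by (auto simp: H_def)
    show "\<exists>y\<in>carrier H. y \<otimes>\<^bsub>H\<^esub> x = \<one>\<^bsub>H\<^esub>"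
      using a by (intro bexI[of _ "f (inv\<^bsub>G\<^esub> a)"]) (auto simp: H_def)
  qed (auto simp: H_def m_assoc)
  have "bij_betw g (carrier H) (carrier G)"
    using f unfolding g_def H_def by (simp add: bij_betw_inv_into inj_on_imp_bij_betw)
  moreover have "g \<in> hom H G"
    by (auto simp: hom_def H_def)
  ultimately have "H \<cong> G"
    by (auto simp: is_iso_def iso_def)
  moreover have "finite (carrier H)"
    using assms(2) by (simp add: H_def)
  ultimately show ?thesis
    using H by blast
qed

end

theory Submission
  imports Defs
begin

text \<open>
  The solvable \<open>K\<FF>\<close>-subnormal subgroup \<open>A\<close> lies in a solvable normal subgroup \<open>R\<close> of \<open>G\<close>
  (lemma \<open>KF_subnormal_solvable_incl_normal_solvable\<close>). This gives the theorem, because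
  \<open>\<langle>A, B\<rangle>\<close> is then contained in \<open>RB\<close>, an extension of the solvable group \<open>R\<close> by a quotient of
  the solvable group \<open>B\<close>.

  To find \<open>R\<close>, one climbs the chain from \<open>A\<close> to \<open>G\<close>, starting with \<open>A\<close> as a normal subgroup of
  itself. Let \<open>M \<le> L\<close> be a link of the chain and let \<open>S\<close> be a solvable normal subgroup of
  \<open>M\<close>; a solvable normal subgroup of \<open>L\<close> that contains \<open>S\<close> is needed.

  If \<open>M\<close> is normal in \<open>L\<close>, the solvable radical of \<open>M\<close> serves, since conjugation by elements of
  \<open>L\<close> permutes the solvable normal subgroups of \<open>M\<close> (lemma \<open>ex_normal_solvable_radical\<close>).

  If instead \<open>M\<close> contains the \<open>\<FF>\<close>-residual of \<open>L\<close>, then it contains some term \<open>N\<close> of the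
  derived series of \<open>L\<close>, because \<open>L\<close> is solvable modulo each of the finitely many normal
  subgroups whose intersection is the residual (lemma \<open>exp_of_derived_incl_residual\<close>). Let \<open>K\<close>
  be the solvable radical of \<open>N\<close>, which is normal in \<open>L\<close>. As \<open>S\<close> and \<open>N\<close> normalize each other,
  \<open>[S, N] \<le> S \<inter> N \<le> K\<close>, so \<open>S\<close> lies in the normal subgroup \<open>C\<close> of all elements of \<open>L\<close>
  that centralize \<open>N\<close> modulo \<open>K\<close>. This \<open>C\<close> is solvable: \<open>C / (C \<inter> N)\<close> embeds into the solvable
  group \<open>L / N\<close>, the quotient \<open>(C \<inter> N) / (C \<inter> K)\<close> is abelian, and \<open>K\<close> is solvable
  (lemma \<open>solvable_normal_lift_derived\<close>).

  Solvability of a subgroup \<open>H\<close> of \<open>G\<close> is expressed by \<^term>\<open>solvable_seq G H\<close>, which refers to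
  the operations of \<open>G\<close> itself and hence allows a comparison of subgroups of different terms of
  the chain.
\<close>

section \<open>Solvable subgroups and the derived series\<close>

text \<open>
  This replaces the closure of solvable groups under extensions: a solvable quotient \<open>H / K\<close> is
  used only through a term of the derived series of \<open>H\<close> that lies in \<open>K\<close>.
\<close>

lemma (in group) solvable_seq_if_exp_of_derived_incl:
  assumes "subgroup H G" and "(derived G ^^ n) H \<subseteq> K" and "solvable_seq G K"
  shows "solvable_seq G H"
proof -
  obtain m where m: "(derived G ^^ m) K = {\<one>}"
    using solvable_imp_trivial_derived_seq[OF assms(3)] by blast
  have "(derived G ^^ (m + n)) H \<subseteq> {\<one>}"
    using mono_exp_of_derived[OF assms(2), of m] m by (simp add: funpow_add)
  moreover have "\<one> \<in> (derived G ^^ (m + n)) H"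
    using exp_of_derived_is_subgroup[OF assms(1)] by (rule subgroup.one_closed)
  ultimately show ?thesis
    using trivial_derived_seq_imp_solvable[OF assms(1)] by blast
qed

lemma (in group) solvable_seq_subgroup:
  assumes "solvable_seq G K" and "subgroup H G" and "H \<subseteq> K"
  shows "solvable_seq G H"
  using solvable_seq_if_exp_of_derived_incl[of H 0 K] assms by simp

lemma (in group) exp_of_derived_consistent:
  assumes "subgroup M G" and "H \<subseteq> M"
  shows "(derived (G\<lparr>carrier := M\<rparr>) ^^ n) H = (derived G ^^ n) H"
proof -
  interpret M: group "G\<lparr>carrier := M\<rparr>"
    using subgroup_imp_group[OF assms(1)] .
  show ?thesis
  proof (induction n)
    case (Suc n)
    have "(derived G ^^ n) H \<subseteq> M"
      using M.exp_of_derived_in_carrier[of H n] assms(2) Suc by simp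
    then show ?case
      using derived_consistent[OF _ assms(1)] Suc by simp
  qed simp
qed

lemma (in group) solvable_seq_iff_trivial_derived_seq:
  "solvable_seq G H \<longleftrightarrow> subgroup H G \<and> (\<exists>n. (derived G ^^ n) H = {\<one>})"
  using solvable_imp_subgroup solvable_imp_trivial_derived_seq trivial_derived_seq_imp_solvable
  by blast

lemma (in group) solvable_seq_consistent:
  assumes "subgroup M G" and "H \<subseteq> M"
  shows "solvable_seq (G\<lparr>carrier := M\<rparr>) H \<longleftrightarrow> solvable_seq G H"
proof -
  interpret M: group "G\<lparr>carrier := M\<rparr>"
    using subgroup_imp_group[OF assms(1)] .
  have sub: "subgroup H (G\<lparr>carrier := M\<rparr>) \<longleftrightarrow> subgroup H G"
    using incl_subgroup[OF assms(1)] subgroup_incl[OF _ assms] by blast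
  show ?thesis
    by (simp add: solvable_seq_iff_trivial_derived_seq M.solvable_seq_iff_trivial_derived_seq
        sub exp_of_derived_consistent[OF assms])
qed

lemma (in group) solvable_iff_solvable_seq:
  assumes "subgroup H G"
  shows "solvable (G\<lparr>carrier := H\<rparr>) \<longleftrightarrow> solvable_seq G H"
  using solvable_seq_consistent[OF assms] by (simp add: solvable_def)

text \<open>
  The derived series commutes with the quotient map, so the term of the derived series of \<open>B\<close>
  where the image becomes trivial lies in the kernel.
\<close>

lemma (in normal) solvable_FactGroup_imp_exp_of_derived_incl:
  assumes "subgroup B G" and "solvable_seq (G Mod H) ((\<lambda>x. H #> x) ` B)"
  shows "\<exists>n. (derived G ^^ n) B \<subseteq> H"
proof -
  interpret \<pi>: group_hom G "G Mod H" "\<lambda>x. H #> x"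
    using factorgroup_is_group r_coset_hom_Mod is_group
    by (simp add: group_hom_def group_hom_axioms_def)
  obtain n where n: "(derived (G Mod H) ^^ n) ((\<lambda>x. H #> x) ` B) = {\<one>\<^bsub>G Mod H\<^esub>}"
    using \<pi>.H.solvable_imp_trivial_derived_seq[OF assms(2)] by blast
  have B: "B \<subseteq> carrier G"
    using assms(1) by (rule subgroup.subset)
  have "(\<lambda>x. H #> x) ` (derived G ^^ n) B = {H}"
    using n \<pi>.exp_of_derived_img[OF B, of n] by simp
  moreover have "x \<in> H #> x" if "x \<in> (derived G ^^ n) B" for x
    using that exp_of_derived_in_carrier[OF B] rcos_self subgroup_axioms by blast
  ultimately show ?thesis by blast
qed

lemma (in group) solvable_seq_normal_mult:
  assumes "N \<lhd> G" and "solvable_seq G N" and "solvable_seq G B"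
  shows "solvable_seq G (N <#> B)"
proof -
  interpret N: normal N G by fact
  interpret \<pi>: group_hom G "G Mod N" "\<lambda>x. N #> x"
    using N.factorgroup_is_group N.r_coset_hom_Mod is_group
    by (simp add: group_hom_def group_hom_axioms_def)
  have B: "subgroup B G"
    using solvable_imp_subgroup[OF assms(3)] .
  have NB: "subgroup (N <#> B) G"
    using mult_norm_subgroup[OF assms(1) B] .
  have coset: "N #> (n \<otimes> b) = N #> b" if "n \<in> N" "b \<in> B" for n b
    using that N.subset subgroup.subset[OF B] coset_mult_assoc[of N n b]
      N.rcos_const[of n] by auto
  have "(\<lambda>x. N #> x) ` (N <#> B) \<subseteq> (\<lambda>x. N #> x) ` B"
    using coset by (auto simp: set_mult_def)
  then have "solvable_seq (G Mod N) ((\<lambda>x. N #> x) ` (N <#> B))"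
    using \<pi>.H.solvable_seq_subgroup \<pi>.solvable_imp_solvable_img[OF assms(3)]
      \<pi>.subgroup_img_is_subgroup[OF NB] by blast
  then show ?thesis
    using N.solvable_FactGroup_imp_exp_of_derived_incl[OF NB]
      solvable_seq_if_exp_of_derived_incl[OF NB _ assms(2)] by blast
qed

section \<open>The solvable radical\<close>

text \<open>
  A maximal solvable normal subgroup contains all others, since the product of two solvable
  normal subgroups is again one.
\<close>

lemma (in group) ex_solvable_radical:
  assumes "finite (carrier G)"
  obtains R where "R \<lhd> G" "solvable_seq G R"
    "\<And>S. S \<lhd> G \<Longrightarrow> solvable_seq G S \<Longrightarrow> S \<subseteq> R"
proof -
  define \<S> where "\<S> = {S. S \<lhd> G \<and> solvable_seq G S}"
  have "\<S> \<subseteq> Pow (carrier G)"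
    unfolding \<S>_def using normal_imp_subgroup subgroup.subset by blast
  then have fin: "finite \<S>"
    using assms by (meson finite_Pow_iff finite_subset)
  have "{\<one>} \<in> \<S>"
    using one_is_normal solvable_seq.unity by (auto simp: \<S>_def)
  then obtain R where R: "R \<in> \<S>" and max: "\<And>S. S \<in> \<S> \<Longrightarrow> R \<subseteq> S \<Longrightarrow> R = S"
    using finite_has_maximal[OF fin] by blast
  have "S \<subseteq> R" if "S \<in> \<S>" for S
  proof -
    have sub: "subgroup R G" "subgroup S G"
      using R that normal_imp_subgroup by (auto simp: \<S>_def)
    have "R <#> S \<in> \<S>"
      using R that normal_subgroup_set_mult_closed solvable_seq_normal_mult by (simp add: \<S>_def)
    moreover have "R \<subseteq> R <#> S" "S \<subseteq> R <#> S"
      using sub subgroup.one_closed[OF sub(1)] subgroup.one_closed[OF sub(2)]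
        subgroup.mem_carrier[OF sub(1)] subgroup.mem_carrier[OF sub(2)]
      by (force simp: set_mult_def)+
    ultimately show ?thesis
      using max by blast
  qed
  with R that show ?thesis
    by (auto simp: \<S>_def)
qed

lemma (in group) conj_group_hom:
  assumes "g \<in> carrier G"
  shows "group_hom G G (\<lambda>x. g \<otimes> x \<otimes> inv g)"
proof -
  have "inv g \<otimes> (g \<otimes> z) = z" if "z \<in> carrier G" for z
    using that assms by (simp flip: m_assoc)
  then show ?thesis
    using assms by unfold_locales (auto simp: hom_def m_assoc)
qed

text \<open>
  The solvable radical of a normal subgroup \<open>M\<close> is normal in the whole group: its conjugates are
  solvable normal subgroups of \<open>M\<close>, hence contained in it.
\<close>

lemma (in group) ex_normal_solvable_radical:
  assumes "finite (carrier G)" and "M \<lhd> G"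
  obtains R where "R \<lhd> G" "solvable_seq G R"
    "\<And>S. S \<lhd> G\<lparr>carrier := M\<rparr> \<Longrightarrow> solvable_seq G S \<Longrightarrow> S \<subseteq> R"
proof -
  have M: "subgroup M G"
    using assms(2) by (rule normal_imp_subgroup)
  interpret M: group "G\<lparr>carrier := M\<rparr>"
    using subgroup_imp_group[OF M] .
  have "finite (carrier (G\<lparr>carrier := M\<rparr>))"
    using subgroup.subset[OF M] assms(1) finite_subset by simp
  then obtain R where R: "R \<lhd> G\<lparr>carrier := M\<rparr>" "solvable_seq (G\<lparr>carrier := M\<rparr>) R"
    and max: "\<And>S. S \<lhd> G\<lparr>carrier := M\<rparr> \<Longrightarrow> solvable_seq (G\<lparr>carrier := M\<rparr>) S \<Longrightarrow> S \<subseteq> R"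
    using M.ex_solvable_radical by blast
  have RM: "R \<subseteq> M"
    using normal_imp_subgroup[OF R(1)] subgroup.subset by fastforce
  have sR: "solvable_seq G R"
    using R(2) solvable_seq_consistent[OF M RM] by simp
  have subR: "subgroup R G"
    using solvable_imp_subgroup[OF sR] .
  have conjM: "g \<otimes> m \<otimes> inv g \<in> M" if "g \<in> carrier G" "m \<in> M" for g m
    using assms(2) that normal_inv_iff by blast
  have conjR: "m \<otimes> r \<otimes> inv m \<in> R" if "m \<in> M" "r \<in> R" for m r
    using M.normal_inv_iff R(1) M that m_inv_consistent by auto
  have "g \<otimes> r \<otimes> inv g \<in> R" if g: "g \<in> carrier G" and r: "r \<in> R" for g r
  proof -
    let ?\<phi> = "\<lambda>x. g \<otimes> x \<otimes> inv g"
    interpret \<phi>: group_hom G G ?\<phi>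
      using conj_group_hom[OF g] .
    have sol: "solvable_seq G (?\<phi> ` R)"
      using \<phi>.solvable_imp_solvable_img[OF sR] .
    have incl: "?\<phi> ` R \<subseteq> M"
      using conjM g RM by blast
    \<comment> \<open>Conjugating \<open>\<phi>(r)\<close> by \<open>m\<close> is applying \<open>\<phi>\<close> to the conjugate of \<open>r\<close> by \<open>\<phi>\<^sup>-\<^sup>1(m)\<close>.\<close>
    have "m \<otimes> ?\<phi> r \<otimes> inv m \<in> ?\<phi> ` R" if m: "m \<in> M" and r: "r \<in> R" for m r
    proof -
      let ?m = "inv g \<otimes> m \<otimes> inv (inv g)"
      have car: "m \<in> carrier G" "r \<in> carrier G"
        using m r M subR by (auto intro: subgroup.mem_carrier)
      have "?m \<in> M"
        using conjM[of "inv g" m] m g by blast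
      then have "?m \<otimes> r \<otimes> inv ?m \<in> R"
        using conjR r by blast
      moreover have "g \<otimes> (inv g \<otimes> z) = z" if "z \<in> carrier G" for z
        using that g by (simp flip: m_assoc)
      then have "m \<otimes> ?\<phi> r \<otimes> inv m = ?\<phi> (?m \<otimes> r \<otimes> inv ?m)"
        using car g by (simp add: m_assoc inv_mult_group)
      ultimately show ?thesis by blast
    qed
    moreover have "subgroup (?\<phi> ` R) (G\<lparr>carrier := M\<rparr>)"
      using subgroup_incl[OF solvable_imp_subgroup[OF sol] M incl] .
    ultimately have "?\<phi> ` R \<lhd> G\<lparr>carrier := M\<rparr>"
      using M.normal_inv_iff M m_inv_consistent by auto
    then have "?\<phi> ` R \<subseteq> R"
      using max solvable_seq_consistent[OF M incl] sol by blast
    then show ?thesis using r by blast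
  qed
  then have "R \<lhd> G"
    using normal_inv_iff subR by blast
  moreover have "S \<subseteq> R" if "S \<lhd> G\<lparr>carrier := M\<rparr>" "solvable_seq G S" for S
  proof -
    have "S \<subseteq> M"
      using normal_imp_subgroup[OF that(1)] subgroup.subset by fastforce
    then show ?thesis
      using max that solvable_seq_consistent[OF M] by blast
  qed
  ultimately show ?thesis
    using that sR by blast
qed

section \<open>Centralizers modulo a normal subgroup\<close>

text \<open>
  For normal \<open>K \<le> N\<close> this is the preimage in \<open>G\<close> of the centralizer of \<open>N / K\<close> in \<open>G / K\<close>.
  The commutator condition makes the elements of \<^const>\<open>derived_set\<close> appear literally.
\<close>

definition centralizer_mod :: "('a, 'b) monoid_scheme \<Rightarrow> 'a set \<Rightarrow> 'a set \<Rightarrow> 'a set" where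
  "centralizer_mod G N K =
     {g \<in> carrier G. \<forall>x\<in>N. g \<otimes>\<^bsub>G\<^esub> x \<otimes>\<^bsub>G\<^esub> inv\<^bsub>G\<^esub> g \<otimes>\<^bsub>G\<^esub> inv\<^bsub>G\<^esub> x \<in> K}"

text \<open>
  Normality comes from the commutator identities
  \<open>[g\<^sup>-\<^sup>1, x] = [g, g\<^sup>-\<^sup>1xg]\<^sup>-\<^sup>1\<close>, \<open>[gh, x] = [g, hxh\<^sup>-\<^sup>1] [h, x]\<close> and
  \<open>[aga\<^sup>-\<^sup>1, x] = a [g, a\<^sup>-\<^sup>1xa] a\<^sup>-\<^sup>1\<close>, where \<open>[g, x] = gxg\<^sup>-\<^sup>1x\<^sup>-\<^sup>1\<close>.
\<close>

lemma (in group) centralizer_mod_normal: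
  assumes "N \<lhd> G" and "K \<lhd> G"
  shows "centralizer_mod G N K \<lhd> G"
proof -
  interpret N: normal N G by fact
  interpret K: normal K G by fact
  have cancel: "g \<otimes> (inv g \<otimes> z) = z" "inv g \<otimes> (g \<otimes> z) = z"
    if "g \<in> carrier G" "z \<in> carrier G" for g z
    using that by (simp_all flip: m_assoc)
  have conjN: "g \<otimes> x \<otimes> inv g \<in> N" "inv g \<otimes> x \<otimes> g \<in> N" if "g \<in> carrier G" "x \<in> N" for g x
    using that N.inv_op_closed1 N.inv_op_closed2 by auto
  note Nc = N.mem_carrier
  show ?thesis
    unfolding normal_inv_iff
  proof (intro conjI ballI subgroupI)
    show "centralizer_mod G N K \<subseteq> carrier G"
      by (auto simp: centralizer_mod_def)
    show "centralizer_mod G N K \<noteq> {}"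
      using Nc K.one_closed by (auto simp: centralizer_mod_def intro!: exI[of _ \<one>])
  next
    fix g assume "g \<in> centralizer_mod G N K"
    then have g: "g \<in> carrier G" and gK: "\<And>x. x \<in> N \<Longrightarrow> g \<otimes> x \<otimes> inv g \<otimes> inv x \<in> K"
      by (auto simp: centralizer_mod_def)
    have "inv g \<otimes> x \<otimes> g \<otimes> inv x \<in> K" if x: "x \<in> N" for x
    proof -
      let ?y = "inv g \<otimes> x \<otimes> g"
      have "inv (g \<otimes> ?y \<otimes> inv g \<otimes> inv ?y) \<in> K"
        using gK conjN(2)[OF g x] K.m_inv_closed by blast
      moreover have "inv (g \<otimes> ?y \<otimes> inv g \<otimes> inv ?y) = inv g \<otimes> x \<otimes> g \<otimes> inv x"
        using g Nc[OF x] by (simp add: m_assoc inv_mult_group cancel)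
      ultimately show ?thesis by simp
    qed
    with g show "inv g \<in> centralizer_mod G N K"
      by (simp add: centralizer_mod_def)
    fix h assume "h \<in> centralizer_mod G N K"
    then have h: "h \<in> carrier G" and hK: "\<And>x. x \<in> N \<Longrightarrow> h \<otimes> x \<otimes> inv h \<otimes> inv x \<in> K"
      by (auto simp: centralizer_mod_def)
    have "g \<otimes> h \<otimes> x \<otimes> inv (g \<otimes> h) \<otimes> inv x \<in> K" if x: "x \<in> N" for x
    proof -
      let ?y = "h \<otimes> x \<otimes> inv h"
      have "(g \<otimes> ?y \<otimes> inv g \<otimes> inv ?y) \<otimes> (h \<otimes> x \<otimes> inv h \<otimes> inv x) \<in> K"
        using gK[OF conjN(1)[OF h x]] hK[OF x] by (rule K.m_closed)
      moreover have "(g \<otimes> ?y \<otimes> inv g \<otimes> inv ?y) \<otimes> (h \<otimes> x \<otimes> inv h \<otimes> inv x)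
          = g \<otimes> h \<otimes> x \<otimes> inv (g \<otimes> h) \<otimes> inv x"
        using g h Nc[OF x] by (simp add: m_assoc inv_mult_group cancel)
      ultimately show ?thesis by simp
    qed
    with g h show "g \<otimes> h \<in> centralizer_mod G N K"
      by (simp add: centralizer_mod_def)
  next
    fix a g assume a: "a \<in> carrier G" and "g \<in> centralizer_mod G N K"
    then have g: "g \<in> carrier G" and gK: "\<And>x. x \<in> N \<Longrightarrow> g \<otimes> x \<otimes> inv g \<otimes> inv x \<in> K"
      by (auto simp: centralizer_mod_def)
    have "(a \<otimes> g \<otimes> inv a) \<otimes> x \<otimes> inv (a \<otimes> g \<otimes> inv a) \<otimes> inv x \<in> K" if x: "x \<in> N" for x
    proof -
      let ?y = "inv a \<otimes> x \<otimes> a"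
      have "a \<otimes> (g \<otimes> ?y \<otimes> inv g \<otimes> inv ?y) \<otimes> inv a \<in> K"
        using gK[OF conjN(2)[OF a x]] a K.inv_op_closed2 by blast
      moreover have "a \<otimes> (g \<otimes> ?y \<otimes> inv g \<otimes> inv ?y) \<otimes> inv a
          = (a \<otimes> g \<otimes> inv a) \<otimes> x \<otimes> inv (a \<otimes> g \<otimes> inv a) \<otimes> inv x"
        using a g Nc[OF x] by (simp add: m_assoc inv_mult_group cancel)
      ultimately show ?thesis by simp
    qed
    with a g show "a \<otimes> g \<otimes> inv a \<in> centralizer_mod G N K"
      by (simp add: centralizer_mod_def)
  qed
qed

lemma (in group) exp_of_derived_carrier_normal:
  "(derived G ^^ n) (carrier G) \<lhd> G"
proof (induction n)
  case 0
  show ?case using normal_inv_iff subgroup_self by simp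
next
  case (Suc n)
  then show ?case using derived_is_normal by simp
qed

text \<open>
  The \<open>n\<close>-th derived subgroup of the centralizer \<open>C\<close> lies in \<open>C \<inter> N\<close>. Elements of \<open>C\<close>
  commute with those of \<open>N\<close> modulo \<open>K\<close>, so one further derivation leads into the solvable \<open>K\<close>.
\<close>

lemma (in group) solvable_seq_centralizer_mod:
  assumes "N \<lhd> G" and "K \<lhd> G" and "solvable_seq G K" and "(derived G ^^ n) (carrier G) \<subseteq> N"
  shows "solvable_seq G (centralizer_mod G N K)"
proof -
  let ?C = "centralizer_mod G N K"
  have C: "subgroup ?C G"
    using centralizer_mod_normal[OF assms(1,2)] by (rule normal_imp_subgroup)
  have "(derived G ^^ n) ?C \<subseteq> N"
    using mono_exp_of_derived[OF subgroup.subset[OF C]] assms(4) by blast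
  moreover have "(derived G ^^ n) ?C \<subseteq> ?C"
    using derived_incl[OF _ C] by (induction n) auto
  ultimately have "derived_set G ((derived G ^^ n) ?C) \<subseteq> K"
    by (auto simp: centralizer_mod_def)
  then have "(derived G ^^ Suc n) ?C \<subseteq> K"
    using generate_subgroup_incl normal_imp_subgroup[OF assms(2)] by (simp add: derived_def)
  then show ?thesis
    using solvable_seq_if_exp_of_derived_incl[OF C _ assms(3)] by blast
qed

section \<open>Climbing a chain of subgroups\<close>

text \<open>
  Here \<open>M\<close> need not be normal, so conjugates of \<open>S\<close> may leave \<open>M\<close>. The normal overgroup of \<open>S\<close>
  is the centralizer modulo \<open>K\<close> of the derived term \<open>N \<subseteq> M\<close>, where \<open>K\<close> is the solvable radical
  of \<open>N\<close>.
\<close>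

lemma (in group) solvable_normal_lift_derived:
  assumes "finite (carrier G)" and "subgroup M G" and "(derived G ^^ n) (carrier G) \<subseteq> M"
    and "S \<lhd> G\<lparr>carrier := M\<rparr>" and "solvable_seq G S"
  obtains R where "R \<lhd> G" "solvable_seq G R" "S \<subseteq> R"
proof -
  define N where "N = (derived G ^^ n) (carrier G)"
  have N: "N \<lhd> G"
    using exp_of_derived_carrier_normal by (simp add: N_def)
  interpret N: normal N G by fact
  have NM: "N \<subseteq> M"
    using assms(3) by (simp add: N_def)
  interpret M: group "G\<lparr>carrier := M\<rparr>"
    using subgroup_imp_group[OF assms(2)] .
  interpret GN: group "G\<lparr>carrier := N\<rparr>"
    using subgroup_imp_group[OF N.subgroup_axioms] .
  have S: "subgroup S G"
    using solvable_imp_subgroup[OF assms(5)] .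
  have conjS: "m \<otimes> s \<otimes> inv m \<in> S" if "m \<in> M" "s \<in> S" for m s
    using M.normal_inv_iff assms(4) assms(2) that m_inv_consistent by auto
  obtain K where K: "K \<lhd> G" "solvable_seq G K"
    and max: "\<And>T. T \<lhd> G\<lparr>carrier := N\<rparr> \<Longrightarrow> solvable_seq G T \<Longrightarrow> T \<subseteq> K"
    using ex_normal_solvable_radical[OF assms(1) N] by blast
  have SN: "subgroup (S \<inter> N) G"
    using subgroups_Inter_pair[OF S N.subgroup_axioms] .
  have "S \<inter> N \<lhd> G\<lparr>carrier := N\<rparr>"
    unfolding GN.normal_inv_iff
  proof (intro conjI ballI)
    show "subgroup (S \<inter> N) (G\<lparr>carrier := N\<rparr>)"
      using subgroup_incl[OF SN N.subgroup_axioms] by simp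
    fix x s assume "x \<in> carrier (G\<lparr>carrier := N\<rparr>)" "s \<in> S \<inter> N"
    then show "x \<otimes>\<^bsub>G\<lparr>carrier := N\<rparr>\<^esub> s \<otimes>\<^bsub>G\<lparr>carrier := N\<rparr>\<^esub> inv\<^bsub>G\<lparr>carrier := N\<rparr>\<^esub> x \<in> S \<inter> N"
      using conjS NM N.subgroup_axioms m_inv_consistent by auto
  qed
  then have SNK: "S \<inter> N \<subseteq> K"
    using max solvable_seq_subgroup[OF assms(5) SN] by blast
  have "S \<subseteq> centralizer_mod G N K"
  proof
    fix s assume s: "s \<in> S"
    then have sG: "s \<in> carrier G"
      by (rule subgroup.mem_carrier[OF S])
    \<comment> \<open>The commutator is \<open>s\<close> times a conjugate of \<open>s\<^sup>-\<^sup>1\<close> by an element of \<open>M\<close>,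
        and also a conjugate of \<open>x\<close> times \<open>x\<^sup>-\<^sup>1\<close>.\<close>
    have "s \<otimes> x \<otimes> inv s \<otimes> inv x \<in> S \<inter> N" if x: "x \<in> N" for x
    proof
      have xG: "x \<in> carrier G"
        using x by (rule N.mem_carrier)
      have "s \<otimes> (x \<otimes> inv s \<otimes> inv x) \<in> S"
        using conjS x NM s S by (blast intro: subgroup.m_closed subgroup.m_inv_closed)
      then show "s \<otimes> x \<otimes> inv s \<otimes> inv x \<in> S"
        using sG xG by (simp add: m_assoc)
      show "s \<otimes> x \<otimes> inv s \<otimes> inv x \<in> N"
        using N.inv_op_closed2[OF sG x] x by (blast intro: N.m_closed N.m_inv_closed)
    qed
    with SNK sG show "s \<in> centralizer_mod G N K"
      by (auto simp: centralizer_mod_def)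
  qed
  then show ?thesis
    using that centralizer_mod_normal[OF N K(1)] solvable_seq_centralizer_mod[OF N K, of n]
    by (simp add: N_def)
qed

lemma (in group) exp_of_derived_carrier_antimono:
  assumes "m \<le> n"
  shows "(derived G ^^ n) (carrier G) \<subseteq> (derived G ^^ m) (carrier G)"
proof -
  obtain k where k: "n = m + k"
    using assms le_Suc_ex by blast
  show ?thesis
    unfolding k funpow_add comp_def
    by (intro mono_exp_of_derived exp_of_derived_in_carrier) simp
qed

text \<open>
  Each normal subgroup with quotient in \<open>\<FF>\<close> has a solvable quotient and so contains a term of the
  derived series. There are finitely many of them and the series is descending, so the
  latest of these terms lies in their intersection. This avoids forming the quotient by the
  residual.
\<close>

lemma (in group) exp_of_derived_incl_residual:
  assumes "group_class \<FF>" and "solvable_class \<FF>" and "finite (carrier G)"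
  shows "\<exists>n. (derived G ^^ n) (carrier G) \<subseteq> residual \<FF> G"
proof -
  define \<N> where "\<N> = {N. N \<lhd> G \<and> in_class \<FF> (G Mod N)}"
  have "\<exists>n. (derived G ^^ n) (carrier G) \<subseteq> N" if "N \<in> \<N>" for N
  proof -
    interpret N: normal N G
      using that by (simp add: \<N>_def)
    have "in_class \<FF> (G Mod N)"
      using that by (simp add: \<N>_def)
    then obtain H where "H \<in> \<FF>" "H \<cong> G Mod N"
      by (auto simp: in_class_def)
    then have H: "group H" "solvable H"
      using assms(1,2) unfolding group_class_def solvable_class_def by blast+
    obtain h where h: "h \<in> iso H (G Mod N)"
      using \<open>H \<cong> G Mod N\<close> by (auto simp: is_iso_def)
    interpret h: group_hom H "G Mod N" h
      using H(1) h N.factorgroup_is_group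
      by (simp add: iso_def group_hom_def group_hom_axioms_def)
    have "h ` carrier H = (\<lambda>x. N #> x) ` carrier G"
      using h by (auto simp: iso_def bij_betw_def FactGroup_def RCOSETS_def)
    then have "solvable_seq (G Mod N) ((\<lambda>x. N #> x) ` carrier G)"
      using h.solvable_imp_solvable_img[of "carrier H"] H(2) by (simp add: solvable_def)
    then show ?thesis
      using N.solvable_FactGroup_imp_exp_of_derived_incl[OF subgroup_self] by blast
  qed
  then obtain n where n: "\<And>N. N \<in> \<N> \<Longrightarrow> (derived G ^^ n N) (carrier G) \<subseteq> N"
    by metis
  have "\<N> \<subseteq> Pow (carrier G)"
    unfolding \<N>_def using normal_imp_subgroup subgroup.subset by blast
  then have "finite (n ` \<N>)"
    using assms(3) by (meson finite_Pow_iff finite_imageI finite_subset)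
  then obtain k where k: "\<And>N. N \<in> \<N> \<Longrightarrow> n N \<le> k"
    by (meson finite_nat_set_iff_bounded_le imageI)
  have "(derived G ^^ k) (carrier G) \<subseteq> N" if "N \<in> \<N>" for N
    using exp_of_derived_carrier_antimono[OF k[OF that]] n[OF that] by blast
  then show ?thesis
    using exp_of_derived_in_carrier[of "carrier G" k]
    by (auto simp: residual_def \<N>_def)
qed

text \<open>
  By induction along the chain, each member \<open>C i\<close> has a solvable normal subgroup containing \<open>A\<close>.
  The two kinds of links are handled inside the group \<open>L\<close> carried by \<open>C (Suc i)\<close>.
\<close>

lemma (in group) KF_subnormal_solvable_incl_normal_solvable:
  assumes "group_class \<FF>" and "solvable_class \<FF>" and "finite (carrier G)"
    and "KF_subnormal \<FF> A G" and "solvable_seq G A"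
  obtains R where "R \<lhd> G" "solvable_seq G R" "A \<subseteq> R"
proof -
  obtain n C where C: "C 0 = A" "C n = carrier G" "\<forall>i\<le>n. subgroup (C i) G"
    and step: "\<forall>i<n. C i \<subseteq> C (Suc i) \<and> (C i \<lhd> G\<lparr>carrier := C (Suc i)\<rparr> \<or>
            residual \<FF> (G\<lparr>carrier := C (Suc i)\<rparr>) \<subseteq> C i)"
    using assms(4) unfolding KF_subnormal_def by (elim exE conjE)
  have "\<exists>R. R \<lhd> G\<lparr>carrier := C i\<rparr> \<and> solvable_seq G R \<and> A \<subseteq> R" if "i \<le> n" for i
    using that
  proof (induction i)
    case 0
    have sA: "subgroup A G"
      using C(1,3) by auto
    interpret A: group "G\<lparr>carrier := A\<rparr>"
      using subgroup_imp_group[OF sA] .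
    have "A \<lhd> G\<lparr>carrier := A\<rparr>"
      using A.exp_of_derived_carrier_normal[of 0] by simp
    then show ?case
      using assms(5) C(1) by auto
  next
    case (Suc i)
    define L where "L = G\<lparr>carrier := C (Suc i)\<rparr>"
    have sub: "subgroup (C i) G" "subgroup (C (Suc i)) G"
      using C(3) Suc.prems by auto
    have Ci: "C i \<subseteq> C (Suc i)"
      using step Suc.prems by simp
    interpret L: group L
      using subgroup_imp_group[OF sub(2)] by (simp add: L_def)
    have fin: "finite (carrier L)"
      using subgroup.subset[OF sub(2)] assms(3) finite_subset by (auto simp: L_def)
    have restr: "L\<lparr>carrier := C i\<rparr> = G\<lparr>carrier := C i\<rparr>"
      by (simp add: L_def)
    have sol: "solvable_seq L T \<longleftrightarrow> solvable_seq G T" if "T \<subseteq> C (Suc i)" for T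
      using solvable_seq_consistent[OF sub(2) that] by (simp add: L_def)
    obtain S where S: "S \<lhd> L\<lparr>carrier := C i\<rparr>" "solvable_seq G S" "A \<subseteq> S"
      using Suc by (auto simp: restr)
    have "S \<subseteq> C i"
      using normal_imp_subgroup[OF S(1)] subgroup.subset by fastforce
    then have SL: "solvable_seq L S"
      using sol S(2) Ci by auto
    obtain R where R: "R \<lhd> L" "solvable_seq L R" "S \<subseteq> R"
    proof (cases "C i \<lhd> L")
      case True
      then show ?thesis
        using L.ex_normal_solvable_radical[OF fin True] S(1) SL that by metis
    next
      case False
      then have "residual \<FF> L \<subseteq> C i"
        using step Suc.prems by (auto simp: L_def Suc_le_eq)
      then obtain k where "(derived L ^^ k) (carrier L) \<subseteq> C i"
        using L.exp_of_derived_incl_residual[OF assms(1,2) fin] by blast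
      moreover have "subgroup (C i) L"
        using subgroup_incl[OF sub Ci] by (simp add: L_def)
      ultimately show ?thesis
        using L.solvable_normal_lift_derived[OF fin _ _ S(1) SL] that by metis
    qed
    have "R \<subseteq> C (Suc i)"
      using subgroup.subset[OF normal_imp_subgroup[OF R(1)]] by (simp add: L_def)
    then show ?case
      using R S(3) sol by (auto simp: L_def)
  qed
  from this[of n] show ?thesis
    using that C(2) by auto
qed

theorem corollary2p1:
  fixes \<FF> :: "nat monoid set" and G :: "('a, 'b) monoid_scheme" and A B :: "'a set"
  assumes "formation \<FF>" and "solvable_class \<FF>" and "subgroup_closed \<FF>"
    and "group G" and "finite (carrier G)"
    and "subgroup A G" and "solvable (G\<lparr>carrier := A\<rparr>)" and "KF_subnormal \<FF> A G"
    and "subgroup B G" and "solvable (G\<lparr>carrier := B\<rparr>)"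
  shows "solvable (G\<lparr>carrier := generate G (A \<union> B)\<rparr>)"
proof -
  interpret group G by fact
  have sA: "solvable_seq G A" and sB: "solvable_seq G B"
    using assms solvable_iff_solvable_seq by auto
  have "group_class \<FF>"
    using assms(1) by (simp add: formation_def)
  then obtain R where R: "R \<lhd> G" "solvable_seq G R" "A \<subseteq> R"
    using KF_subnormal_solvable_incl_normal_solvable[OF _ assms(2,5,8) sA] by blast
  have sRB: "solvable_seq G (R <#>\<^bsub>G\<^esub> B)"
    using solvable_seq_normal_mult[OF R(1,2) sB] .
  have sub: "subgroup R G"
    using normal_imp_subgroup[OF R(1)] .
  have "R \<subseteq> R <#>\<^bsub>G\<^esub> B" "B \<subseteq> R <#>\<^bsub>G\<^esub> B"
    using subgroup.one_closed[OF sub] subgroup.one_closed[OF assms(9)]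
      subgroup.mem_carrier[OF sub] subgroup.mem_carrier[OF assms(9)]
    by (force simp: set_mult_def)+
  then have "generate G (A \<union> B) \<subseteq> R <#>\<^bsub>G\<^esub> B"
    using R(3) generate_subgroup_incl[OF _ solvable_imp_subgroup[OF sRB]] by blast
  moreover have gen: "subgroup (generate G (A \<union> B)) G"
    using generate_is_subgroup subgroup.subset[OF assms(6)] subgroup.subset[OF assms(9)] by simp
  ultimately show ?thesis
    using solvable_seq_subgroup[OF sRB] solvable_iff_solvable_seq by blast
qed

end
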